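(* Let $K$ be a commutative field, let $F\subset\mathbb{P}_3(K)$ be the Cayley surface $F=\mathcal{V}(X_0X_1X_2-X_1^3-X_0^2X_3)$, let $g_\infty=\mathcal{V}(X_0,X_1)$, and let $\mathcal{O}$ be the set of lines of $\mathbb{P}_3(K)$ consisting of all proper osculating tangents of $F$ together with the line $g_\infty$. Then $\mathcal{O}$ is a spread if, and only if, it is a dual spread; and $\mathcal{O}$ is a maximal partial spread if, and only if, it is a maximal partial dual spread.
   Context: Points of the three-dimensional projective space $\mathbb{P}_3(K)$ are the one-dimensional subspaces $K\mathbf{p}$ with $0\neq\mathbf{p}=(p_0,p_1,p_2,p_3)^{T}\in K^{4\times1}$. For homogeneous polynomials $g_1,\dots,g_r\in K[X_0,X_1,X_2,X_3]$, $\mathcal{V}(g_1,\dots,g_r)$ denotes the set of points $K\mathbf{p}$ of $\mathbb{P}_3(K)$ with $g_1(\mathbf{p})=\dots=g_r(\mathbf{p})=0$. Put $f:=X_0X_1X_2-X_1^3-X_0^2X_3$, so $F=\mathcal{V}(f)$. A point of $F$ is simple if not all the partial derivatives $\partial f/\partial X_i$ vanish there. The simple points of $F$ are exactly the points of $F$ outside the plane $\omega=\mathcal{V}(X_0)$, namely $P(u_1,u_2)=K(1,u_1,u_2,u_1u_2-u_1^3)^T$ with $(u_1,u_2)\in K^2$. A generator of $F$ is one of the lines spanned by $K(s_0^2,s_0s_1,s_1^2,0)^T$ and $K(0,0,s_0,s_1)^T$, with $(s_0,s_1)\in K^2\setminus\{(0,0)\}$; these are the lines contained in $F$. A line $t$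 is an osculating tangent of $F$ at a simple point $P=K\mathbf{p}$ if it meets $F$ at $P$ with multiplicity $\geq 3$: for $t=K\mathbf{p}+K\mathbf{q}$ the polynomial $f(\mathbf{p}+T\mathbf{q})\in K[T]$ is divisible by $T^3$ (possibly zero). A proper osculating tangent of $F$ is an osculating tangent at some simple point that is not a generator of $F$. A set of lines of $\mathbb{P}_3(K)$ is a partial spread if each point is incident with at most one of its lines, and a spread if each point is incident with exactly one of its lines. Dually, it is a partial dual spread if each plane is incident with (contains) at most one of its lines, and a dual spread if each plane contains exactly one of its lines. A partial (dual) spread is maximal if it is not a proper subset of any partial (dual) spread. *)

theory Defs
  imports "HOL-Analysis.Cartesian_Space" "HOL-Computational_Algebra.Polynomial"
begin

text \<open>The projective space \<open>P\<^sub>3(K)\<close> is modelled on the subspaces of \<open>K\<^sup>4\<close>, with inclusion as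
  incidence. The index type \<open>4\<close> has the elements 0, 1, 2, 3, so that \<open>p $ i\<close> is the
  homogeneous coordinate \<open>p\<^sub>i\<close>.\<close>

definition proj_points :: "('k::field ^ 4) set set" where
  "proj_points = {P. vec.subspace P \<and> vec.dim P = 1}"

definition proj_lines :: "('k::field ^ 4) set set" where
  "proj_lines = {t. vec.subspace t \<and> vec.dim t = 2}"

definition proj_planes :: "('k::field ^ 4) set set" where
  "proj_planes = {E. vec.subspace E \<and> vec.dim E = 3}"

definition coords :: "'k \<Rightarrow> 'k \<Rightarrow> 'k \<Rightarrow> 'k \<Rightarrow> 'k ^ 4" where
  "coords a b c d = (\<chi> i. if i = 0 then a else if i = 1 then b else if i = 2 then c else d)"

text \<open>The form \<open>f = X\<^sub>0X\<^sub>1X\<^sub>2 - X\<^sub>1\<^sup>3 - X\<^sub>0\<^sup>2X\<^sub>3\<close> is given by its evaluation in an arbitrary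
  commutative ring. Evaluating it in \<open>K[T]\<close> yields formal derivatives and contact orders,
  which are also meaningful over finite fields.\<close>

definition cayley_form :: "(4 \<Rightarrow> 'r::comm_ring_1) \<Rightarrow> 'r" where
  "cayley_form x = x 0 * x 1 * x 2 - x 1 ^ 3 - (x 0)\<^sup>2 * x 3"

definition cayley_surface :: "('k::field ^ 4) set set" where
  "cayley_surface = {vec.span {p} |p. p \<noteq> 0 \<and> cayley_form (\<lambda>i. p $ i) = 0}"

text \<open>The formal partial derivative of \<open>f\<close> with respect to \<open>X\<^sub>i\<close>, evaluated at \<open>p\<close>: substitute
  \<open>p\<^sub>j\<close> for every \<open>X\<^sub>j\<close> with \<open>j \<noteq> i\<close>, differentiate in the remaining variable, and evaluate at
  \<open>p\<^sub>i\<close>.\<close>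

definition cayley_partial :: "4 \<Rightarrow> 'k::field ^ 4 \<Rightarrow> 'k" where
  "cayley_partial i p =
     poly (pderiv (cayley_form (\<lambda>j. if j = i then [:0, 1:] else [:p $ j:]))) (p $ i)"

definition simple_points :: "('k::field ^ 4) set set" where
  "simple_points =
     {vec.span {p} |p. p \<noteq> 0 \<and> vec.span {p} \<in> cayley_surface \<and> (\<exists>i. cayley_partial i p \<noteq> 0)}"

definition generators :: "('k::field ^ 4) set set" where
  "generators =
     {vec.span {coords (s0\<^sup>2) (s0 * s1) (s1\<^sup>2) 0, coords 0 0 s0 s1} |s0 s1. (s0, s1) \<noteq> (0, 0)}"

text \<open>The polynomial \<open>[:p $ i, q $ i:]\<close> is \<open>p\<^sub>i + T q\<^sub>i\<close>, and \<open>monom 1 3\<close> is \<open>T\<^sup>3\<close>. The divisibility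
  condition does not depend on the choice of \<open>p\<close> and \<open>q\<close>.\<close>

definition osculating_tangent_at :: "('k::field ^ 4) set \<Rightarrow> ('k ^ 4) set \<Rightarrow> bool" where
  "osculating_tangent_at P t \<longleftrightarrow>
     P \<in> simple_points \<and> t \<in> proj_lines \<and>
     (\<exists>p q. P = vec.span {p} \<and> t = vec.span {p, q} \<and>
        monom 1 3 dvd cayley_form (\<lambda>i. [:p $ i, q $ i:]))"

definition proper_osculating_tangents :: "('k::field ^ 4) set set" where
  "proper_osculating_tangents = {t. \<exists>P. osculating_tangent_at P t} - generators"

definition g_infinity :: "('k::field ^ 4) set" where
  "g_infinity = {x. x $ 0 = 0 \<and> x $ 1 = 0}"

definition partial_spread :: "('k::field ^ 4) set set \<Rightarrow> bool" where
  "partial_spread S \<longleftrightarrow> S \<subseteq> proj_lines \<and>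
     (\<forall>P\<in>proj_points. \<forall>s\<in>S. \<forall>t\<in>S. P \<subseteq> s \<and> P \<subseteq> t \<longrightarrow> s = t)"

definition spread :: "('k::field ^ 4) set set \<Rightarrow> bool" where
  "spread S \<longleftrightarrow> S \<subseteq> proj_lines \<and> (\<forall>P\<in>proj_points. \<exists>!t. t \<in> S \<and> P \<subseteq> t)"

definition partial_dual_spread :: "('k::field ^ 4) set set \<Rightarrow> bool" where
  "partial_dual_spread S \<longleftrightarrow> S \<subseteq> proj_lines \<and>
     (\<forall>E\<in>proj_planes. \<forall>s\<in>S. \<forall>t\<in>S. s \<subseteq> E \<and> t \<subseteq> E \<longrightarrow> s = t)"

definition dual_spread :: "('k::field ^ 4) set set \<Rightarrow> bool" where
  "dual_spread S \<longleftrightarrow> S \<subseteq> proj_lines \<and> (\<forall>E\<in>proj_planes. \<exists>!t. t \<in> S \<and> t \<subseteq> E)"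

definition maximal_partial_spread :: "('k::field ^ 4) set set \<Rightarrow> bool" where
  "maximal_partial_spread S \<longleftrightarrow> partial_spread S \<and> \<not> (\<exists>S'. partial_spread S' \<and> S \<subset> S')"

definition maximal_partial_dual_spread :: "('k::field ^ 4) set set \<Rightarrow> bool" where
  "maximal_partial_dual_spread S \<longleftrightarrow>
     partial_dual_spread S \<and> \<not> (\<exists>S'. partial_dual_spread S' \<and> S \<subset> S')"

end

theory Submission
  imports Defs
begin

text \<open>
  Two distinct lines of \<open>P\<^sub>3(K)\<close> have a common point if and only if they lie in a common plane, so
  partial spreads and partial dual spreads are the same sets of lines, whence the claim on
  maximality. The proper osculating tangent at \<open>P(u,v)\<close> is the line
  \<open>X\<^sub>2 = (v - 3u\<^sup>2)X\<^sub>0 + 3uX\<^sub>1\<close>, \<open>X\<^sub>3 = -u\<^sup>3X\<^sub>0 + vX\<^sub>1\<close>. The null polarity of the alternating form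
  \<open>X\<^sub>0Y\<^sub>3 - X\<^sub>1Y\<^sub>2 + X\<^sub>2Y\<^sub>1 - X\<^sub>3Y\<^sub>0\<close> interchanges the tangents at \<open>P(u,v)\<close> and \<open>P(u,3u\<^sup>2 - v)\<close> and
  fixes \<open>g\<^sub>\<infinity>\<close>. It therefore leaves \<open>\<O>\<close> invariant, and it exchanges points with planes.
\<close>

text \<open>The enumerations \<open>forall_4\<close> and \<open>exhaust_4\<close> run over 1, 2, 3,
  4, while homogeneous coordinates are numbered from 0.\<close>

lemma four_eq_zero: "(4 :: 4) = 0"
  by simp

lemma vec4_eq_iff:
  fixes x y :: "'a ^ 4"
  shows "x = y \<longleftrightarrow> x $ 0 = y $ 0 \<and> x $ 1 = y $ 1 \<and> x $ 2 = y $ 2 \<and> x $ 3 = y $ 3"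
  by (auto simp: vec_eq_iff forall_4 four_eq_zero)

lemma coords_nth [simp]:
  "coords a b c d $ 0 = a" "coords a b c d $ 1 = b" "coords a b c d $ 2 = c" "coords a b c d $ 3 = d"
  by (simp_all add: coords_def)

lemma span_pair:
  fixes p q :: "'k::field ^ 'n"
  shows "x \<in> vec.span {p, q} \<longleftrightarrow> (\<exists>a b. x = a *s p + b *s q)"
  by (auto simp: vec.span_insert vec.span_singleton algebra_simps)

subsection \<open>Partial spreads and partial dual spreads\<close>

lemma proj_lines_dim_sums_Int:
  fixes s t :: "('k::field ^ 4) set"
  assumes "s \<in> proj_lines" "t \<in> proj_lines"
  shows "vec.dim {x + y |x y. x \<in> s \<and> y \<in> t} + vec.dim (s \<inter> t) = 4"
  using vec.dim_sums_Int[of s t] assms by (simp add: proj_lines_def)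

lemma proj_lines_eqI:
  assumes "s \<in> proj_lines" "t \<in> proj_lines" "s \<subseteq> t"
  shows "s = t"
  using assms vec.subspace_dim_equal[of s t] by (simp add: proj_lines_def)

text \<open>The dimensions of the sum and of the intersection add up to 4. As the lines differ, the
  sum has dimension at least 3 and the intersection at most 1. So the intersection is a point
  exactly when the sum is a plane.\<close>

lemma common_point_iff_common_plane:
  fixes s t :: "('k::field ^ 4) set"
  assumes s: "s \<in> proj_lines" and t: "t \<in> proj_lines" and "s \<noteq> t"
  shows "(\<exists>P\<in>proj_points. P \<subseteq> s \<and> P \<subseteq> t) \<longleftrightarrow> (\<exists>E\<in>proj_planes. s \<subseteq> E \<and> t \<subseteq> E)"
proof
  let ?S = "{x + y |x y. x \<in> s \<and> y \<in> t}"
  have sub: "vec.subspace s" "vec.subspace t" and dims: "vec.dim s = 2" "vec.dim t = 2"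
    using s t by (auto simp: proj_lines_def)
  have subI: "vec.subspace (s \<inter> t)"
    using sub by (rule vec.subspace_inter)
  have subS: "vec.subspace ?S"
    using sub by (rule vec.subspace_sums)
  have 4: "vec.dim ?S + vec.dim (s \<inter> t) = 4"
    using s t by (rule proj_lines_dim_sums_Int)
  have sS: "s \<subseteq> ?S"
    using vec.subspace_0[OF sub(2)] by force
  have tS: "t \<subseteq> ?S"
    using vec.subspace_0[OF sub(1)] by force
  {
    assume "\<exists>P\<in>proj_points. P \<subseteq> s \<and> P \<subseteq> t"
    then obtain P where P: "vec.subspace P" "vec.dim P = 1" "P \<subseteq> s \<inter> t"
      by (auto simp: proj_points_def)
    have ge1: "vec.dim (s \<inter> t) \<ge> 1"
      using vec.dim_subset[OF P(3)] P(2) by simp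
    have "vec.dim ?S \<noteq> 2"
    proof
      assume "vec.dim ?S = 2"
      then have "s = ?S" "t = ?S"
        using vec.subspace_dim_equal[OF sub(1) subS sS] vec.subspace_dim_equal[OF sub(2) subS tS] dims
        by auto
      with \<open>s \<noteq> t\<close> show False by simp
    qed
    moreover have "vec.dim ?S \<ge> 2"
      using vec.dim_subset[OF sS] dims by simp
    ultimately have "vec.dim ?S = 3"
      using 4 ge1 by simp
    then show "\<exists>E\<in>proj_planes. s \<subseteq> E \<and> t \<subseteq> E"
      using subS sS tS by (auto simp: proj_planes_def)
  next
    assume "\<exists>E\<in>proj_planes. s \<subseteq> E \<and> t \<subseteq> E"
    then obtain E where E: "vec.subspace E" "vec.dim E = 3" "s \<subseteq> E" "t \<subseteq> E"
      by (auto simp: proj_planes_def)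
    have "x + y \<in> E" if "x \<in> s" "y \<in> t" for x y
      using that E(3,4) by (intro vec.subspace_add[OF E(1)]) auto
    then have "?S \<subseteq> E"
      by blast
    then have "vec.dim ?S \<le> 3"
      using vec.dim_subset[of ?S E] E(2) by simp
    moreover have "vec.dim (s \<inter> t) \<noteq> 2"
    proof
      assume "vec.dim (s \<inter> t) = 2"
      then have "s \<inter> t \<in> proj_lines"
        using subI by (simp add: proj_lines_def)
      then have "s \<inter> t = s" "s \<inter> t = t"
        using proj_lines_eqI s t by blast+
      with \<open>s \<noteq> t\<close> show False by simp
    qed
    moreover have "vec.dim (s \<inter> t) \<le> 2"
      using vec.dim_subset[of "s \<inter> t" s] dims by simp
    ultimately have "vec.dim (s \<inter> t) = 1"
      using 4 by simp
    then show "\<exists>P\<in>proj_points. P \<subseteq> s \<and> P \<subseteq> t"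
      using subI by (auto simp: proj_points_def intro!: bexI[of _ "s \<inter> t"])
  }
qed

lemma partial_spread_iff_partial_dual_spread:
  fixes S :: "('k::field ^ 4) set set"
  shows "partial_spread S \<longleftrightarrow> partial_dual_spread S"
proof (cases "S \<subseteq> proj_lines")
  case True
  have *: "(\<exists>P\<in>proj_points. P \<subseteq> s \<and> P \<subseteq> t) \<longleftrightarrow> (\<exists>E\<in>proj_planes. s \<subseteq> E \<and> t \<subseteq> E)"
    if "s \<in> S" "t \<in> S" "s \<noteq> t" for s t
    using that True by (intro common_point_iff_common_plane) auto
  have "partial_spread S \<longleftrightarrow>
      (\<forall>s\<in>S. \<forall>t\<in>S. s \<noteq> t \<longrightarrow> \<not> (\<exists>P\<in>proj_points. P \<subseteq> s \<and> P \<subseteq> t))"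
    using True unfolding partial_spread_def by blast
  also have "\<dots> \<longleftrightarrow>
      (\<forall>s\<in>S. \<forall>t\<in>S. s \<noteq> t \<longrightarrow> \<not> (\<exists>E\<in>proj_planes. s \<subseteq> E \<and> t \<subseteq> E))"
    by (intro ball_cong refl imp_cong arg_cong[of _ _ Not] *)
  also have "\<dots> \<longleftrightarrow> partial_dual_spread S"
    using True unfolding partial_dual_spread_def by blast
  finally show ?thesis .
qed (simp add: partial_spread_def partial_dual_spread_def)

text \<open>Splits off uniqueness, which is self-dual, so that only the covering condition has to be
  carried from points to planes and back.\<close>

lemma spread_iff:
  "spread S \<longleftrightarrow> partial_spread S \<and> (\<forall>P\<in>proj_points. \<exists>t\<in>S. P \<subseteq> t)"
  unfolding spread_def partial_spread_def by blast

lemma dual_spread_iff: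
  "dual_spread S \<longleftrightarrow> partial_dual_spread S \<and> (\<forall>E\<in>proj_planes. \<exists>t\<in>S. t \<subseteq> E)"
  unfolding dual_spread_def partial_dual_spread_def by blast

subsection \<open>The null polarity\<close>

definition null_form :: "'k::field ^ 4 \<Rightarrow> 'k ^ 4 \<Rightarrow> 'k" where
  "null_form x y = x $ 0 * y $ 3 - x $ 1 * y $ 2 + x $ 2 * y $ 1 - x $ 3 * y $ 0"

definition null_perp :: "('k::field ^ 4) set \<Rightarrow> ('k ^ 4) set" where
  "null_perp t = {x. \<forall>y\<in>t. null_form x y = 0}"

lemma null_form_linear:
  "null_form (x + x') y = null_form x y + null_form x' y"
  "null_form (x - x') y = null_form x y - null_form x' y"
  "null_form (c *s x) y = c * null_form x y"
  "null_form 0 y = 0"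
  by (simp_all add: null_form_def algebra_simps)

lemma null_form_commute: "null_form x y = 0 \<longleftrightarrow> null_form y x = 0"
proof -
  have "null_form x y = - null_form y x"
    by (simp add: null_form_def algebra_simps)
  then show ?thesis by simp
qed

text \<open>Nondegeneracy of the form: a nonzero coordinate of \<open>p\<close> is paired with the
  basis vector of the complementary index, scaled to give the value 1.\<close>

lemma exists_null_form_eq_1:
  assumes "p \<noteq> 0"
  obtains w where "null_form w p = 1"
proof -
  consider "p $ 0 \<noteq> 0" | "p $ 1 \<noteq> 0" | "p $ 2 \<noteq> 0" | "p $ 3 \<noteq> 0"
    using assms by (auto simp: vec4_eq_iff)
  then show ?thesis
  proof cases
    case 1
    then show ?thesis by (intro that[of "coords 0 0 0 (- inverse (p $ 0))"]) (simp add: null_form_def)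
  next
    case 2
    then show ?thesis by (intro that[of "coords 0 0 (inverse (p $ 1)) 0"]) (simp add: null_form_def)
  next
    case 3
    then show ?thesis by (intro that[of "coords 0 (- inverse (p $ 2)) 0 0"]) (simp add: null_form_def)
  next
    case 4
    then show ?thesis by (intro that[of "coords (inverse (p $ 3)) 0 0 0"]) (simp add: null_form_def)
  qed
qed

lemma null_form_plane:
  assumes "p \<noteq> 0"
  shows "{x. null_form x p = 0} \<in> proj_planes"
proof -
  let ?E = "{x. null_form x p = 0}"
  obtain w where w: "null_form w p = 1"
    using assms exists_null_form_eq_1 by blast
  have sub: "vec.subspace ?E"
    by (auto simp: vec.subspace_def null_form_linear)
  \<comment> \<open>Subtracting the right multiple of \<open>w\<close> moves \<open>x\<close> into
    the kernel. So the single vector \<open>w\<close>, which is outside the kernel, completes it to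
    the whole space.\<close>
  have "x \<in> vec.span (insert w ?E)" for x
  proof -
    have "x - null_form x p *s w \<in> vec.span ?E"
      by (rule vec.span_base) (simp add: null_form_linear w)
    then show ?thesis by (auto simp: vec.span_insert)
  qed
  then have "vec.span (insert w ?E) = UNIV" by blast
  then have "vec.dim (insert w ?E) = 4"
    using vec.dim_span[of "insert w ?E"] vec_dim_card[where ?'a = 'a and ?'n = 4]
    by (simp del: vec.dim_UNIV)
  moreover have "w \<notin> vec.span ?E"
    using w by (simp add: vec.span_eq_iff[THEN iffD2, OF sub])
  ultimately have "vec.dim ?E = 3"
    by (simp add: vec.dim_insert)
  then show ?thesis
    using sub by (simp add: proj_planes_def)
qed

text \<open>The vector \<open>p\<close> lists the values on the standard basis, reversed and with
  the signs of the form. The functional is a coordinate of a vector-valued map because the map later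
  extended from a basis takes values in \<open>'k ^ 4\<close>.\<close>

lemma linear_functional_eq_null_form:
  fixes g :: "'k::field ^ 4 \<Rightarrow> 'k ^ 'n"
  assumes "Vector_Spaces.linear (*s) (*s) g"
  shows "\<exists>p. \<forall>x. g x $ i = null_form x p"
proof -
  interpret g: Vector_Spaces.linear "(*s)" "(*s)" g by fact
  let ?\<phi> = "\<lambda>a b c d. g (coords a b c d) $ i"
  let ?p = "coords (- ?\<phi> 0 0 0 1) (?\<phi> 0 0 1 0) (- ?\<phi> 0 1 0 0) (?\<phi> 1 0 0 0)"
  have "g x $ i = null_form x ?p" for x
  proof -
    have "x = x $ 0 *s coords 1 0 0 0 + x $ 1 *s coords 0 1 0 0 + x $ 2 *s coords 0 0 1 0
              + x $ 3 *s coords 0 0 0 1"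
      by (simp add: vec4_eq_iff)
    then have "g x = x $ 0 *s g (coords 1 0 0 0) + x $ 1 *s g (coords 0 1 0 0)
              + x $ 2 *s g (coords 0 0 1 0) + x $ 3 *s g (coords 0 0 0 1)"
      by (metis g.add g.scale)
    then show ?thesis by (simp add: null_form_def)
  qed
  then show ?thesis by blast
qed

text \<open>A functional that vanishes on a basis of the plane but not at some outside vector has a
  kernel of dimension 3 containing the plane, hence equal to it.\<close>

lemma plane_eq_null_form:
  fixes E :: "('k::field ^ 4) set"
  assumes "E \<in> proj_planes"
  obtains p where "p \<noteq> 0" "E = {x. null_form x p = 0}"
proof -
  have sub: "vec.subspace E" and dim: "vec.dim E = 3"
    using assms by (auto simp: proj_planes_def)
  obtain B where B: "B \<subseteq> E" "vec.independent B" "E \<subseteq> vec.span B"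
    by (rule vec.basis_exists[of E])
  have "vec.dim (UNIV :: ('k ^ 4) set) = 4"
    using vec_dim_card[where ?'a = 'k and ?'n = 4] by (simp del: vec.dim_UNIV)
  then have "E \<noteq> UNIV"
    using dim by (auto simp del: vec.dim_UNIV)
  then obtain w where w: "w \<notin> E" by blast
  have span: "vec.span B = E"
    using B sub by (metis vec.span_minimal subset_antisym)
  then have "vec.independent (insert w B)"
    using B(2) w by (simp add: vec.independent_insert)
  \<comment> \<open>Here 1 is the all-ones vector, so coordinate 0 of \<open>g\<close> is 1 at
    \<open>w\<close> and 0 on \<open>B\<close>.\<close>
  then obtain g :: "'k ^ 4 \<Rightarrow> 'k ^ 4"
    where g: "Vector_Spaces.linear (*s) (*s) g"
      and gB: "\<forall>x\<in>insert w B. g x = (if x = w then 1 else 0)"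
    using vec.linear_independent_extend[of "insert w B" "\<lambda>x. if x = w then 1 else 0"] by blast
  obtain p where p: "\<And>x. g x $ 0 = null_form x p"
    using linear_functional_eq_null_form[OF g, of 0] by metis
  have wp: "null_form w p = 1"
    using gB p[of w] by simp
  have "p \<noteq> 0"
    using wp by (auto simp: null_form_def)
  then have E': "{x. null_form x p = 0} \<in> proj_planes"
    by (rule null_form_plane)
  have "null_form x p = 0" if "x \<in> B" for x
  proof -
    have "x \<noteq> w"
      using w B(1) that by blast
    then have "g x = 0"
      using gB that by simp
    then show ?thesis
      using p[of x] by simp
  qed
  then have "vec.span B \<subseteq> {x. null_form x p = 0}"
    using E' by (intro vec.span_minimal) (auto simp: proj_planes_def)
  then have "E \<subseteq> {x. null_form x p = 0}"
    by (simp add: span)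
  then have "E = {x. null_form x p = 0}"
    using E' sub dim by (intro vec.subspace_dim_equal) (auto simp: proj_planes_def)
  with \<open>p \<noteq> 0\<close> show ?thesis by (rule that)
qed

lemma proj_points_span:
  fixes P :: "('k::field ^ 4) set"
  assumes "P \<in> proj_points"
  obtains p where "p \<noteq> 0" "P = vec.span {p}"
proof -
  have sub: "vec.subspace P" and dim: "vec.dim P = 1"
    using assms by (auto simp: proj_points_def)
  then have "\<not> P \<subseteq> {0}"
    using vec.dim_eq_0 by (metis zero_neq_one)
  then obtain p where p: "p \<in> P" "p \<noteq> 0" by blast
  have "vec.span {p} \<subseteq> P"
    using p sub by (simp add: vec.span_minimal)
  moreover have "vec.dim (vec.span {p}) = 1"
    using p by (simp add: vec.dim_insert)
  ultimately have "P = vec.span {p}"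
    using sub dim vec.subspace_dim_equal[of "vec.span {p}" P] by simp
  then show ?thesis using that p by blast
qed

lemma span_singleton_in_proj_points:
  fixes p :: "'k::field ^ 4"
  assumes "p \<noteq> 0"
  shows "vec.span {p} \<in> proj_points"
  using assms by (simp add: proj_points_def vec.dim_insert)

text \<open>A line through the pole of a plane has its polar line inside that plane. Conversely, a
  line inside the polar plane of a point has its polar line through that point, by symmetry of
  orthogonality.\<close>

lemma spread_iff_dual_spread_if_null_perp_invariant:
  fixes S :: "('k::field ^ 4) set set"
  assumes "\<And>t. t \<in> S \<Longrightarrow> null_perp t \<in> S"
  shows "spread S \<longleftrightarrow> dual_spread S"
proof (cases "S \<subseteq> proj_lines")
  case True
  have "(\<forall>P\<in>proj_points. \<exists>t\<in>S. P \<subseteq> t) \<longleftrightarrow> (\<forall>E\<in>proj_planes. \<exists>t\<in>S. t \<subseteq> E)"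
  proof (intro iffI ballI)
    fix E :: "('k ^ 4) set"
    assume cover: "\<forall>P\<in>proj_points. \<exists>t\<in>S. P \<subseteq> t" and "E \<in> proj_planes"
    then obtain p where p: "p \<noteq> 0" "E = {x. null_form x p = 0}"
      using plane_eq_null_form by blast
    then obtain t where "t \<in> S" "vec.span {p} \<subseteq> t"
      using cover span_singleton_in_proj_points by blast
    then have "p \<in> t"
      using vec.span_base by blast
    then have "null_perp t \<subseteq> E"
      using p by (auto simp: null_perp_def)
    with \<open>t \<in> S\<close> assms show "\<exists>t\<in>S. t \<subseteq> E" by blast
  next
    fix P :: "('k ^ 4) set"
    assume cover: "\<forall>E\<in>proj_planes. \<exists>t\<in>S. t \<subseteq> E" and "P \<in> proj_points"
    then obtain p where p: "p \<noteq> 0" "P = vec.span {p}"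
      using proj_points_span by blast
    then obtain t where t: "t \<in> S" "t \<subseteq> {x. null_form x p = 0}"
      using cover null_form_plane by blast
    then have "p \<in> null_perp t"
      using null_form_commute by (auto simp: null_perp_def)
    moreover have "vec.subspace (null_perp t)"
      using t True assms by (auto simp: proj_lines_def)
    ultimately have "P \<subseteq> null_perp t"
      using p by (simp add: vec.span_minimal)
    with t assms show "\<exists>t\<in>S. P \<subseteq> t" by blast
  qed
  then show ?thesis
    by (simp add: spread_iff dual_spread_iff partial_spread_iff_partial_dual_spread)
qed (simp add: spread_def dual_spread_def)

subsection \<open>The proper osculating tangents\<close>

definition tangent_line :: "'k::field \<Rightarrow> 'k \<Rightarrow> ('k ^ 4) set" where
  "tangent_line u v =
     {x. x $ 2 = (v - 3 * u\<^sup>2) * x $ 0 + 3 * u * x $ 1 \<and> x $ 3 = v * x $ 1 - u ^ 3 * x $ 0}"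

text \<open>The spanning vectors represent the point of contact \<open>P(u,v)\<close> and the point
  where the line meets the plane at infinity.\<close>

lemma tangent_line_eq_span:
  "tangent_line u v = vec.span {coords 1 u v (u * v - u ^ 3), coords 0 1 (3 * u) v}"
proof (rule set_eqI)
  fix x
  show "x \<in> tangent_line u v \<longleftrightarrow>
      x \<in> vec.span {coords 1 u v (u * v - u ^ 3), coords 0 1 (3 * u) v}"
    unfolding span_pair
  proof
    assume "x \<in> tangent_line u v"
    \<comment> \<open>The two coefficients are forced by coordinates 0 and 1.\<close>
    then have "x = x $ 0 *s coords 1 u v (u * v - u ^ 3)
        + (x $ 1 - u * x $ 0) *s coords 0 1 (3 * u) v"
      by (simp add: tangent_line_def vec4_eq_iff algebra_simps power2_eq_square)
    then show "\<exists>a b. x = a *s coords 1 u v (u * v - u ^ 3) + b *s coords 0 1 (3 * u) v"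
      by blast
  qed (auto simp: tangent_line_def algebra_simps power2_eq_square)
qed

lemma tangent_line_in_proj_lines: "tangent_line u v \<in> proj_lines"
proof -
  let ?p = "coords 1 u v (u * v - u ^ 3)" and ?q = "coords 0 1 (3 * u) v"
  have "?p \<notin> vec.span {?q}"
    by (auto simp: vec.span_singleton vec4_eq_iff)
  moreover have "?q \<noteq> 0"
    by (simp add: vec4_eq_iff)
  ultimately have "vec.dim {?p, ?q} = 2"
    by (simp add: vec.dim_insert)
  then show ?thesis
    by (simp add: tangent_line_eq_span proj_lines_def)
qed

lemma null_perp_tangent_line: "null_perp (tangent_line u v) = tangent_line u (3 * u\<^sup>2 - v)"
proof (intro set_eqI iffI)
  fix x assume x: "x \<in> null_perp (tangent_line u v)"
  \<comment> \<open>These two points span the line; the first is the contact vector minus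
    \<open>u\<close> times the second. Orthogonality to them yields the two equations of the image
    line.\<close>
  have "coords 1 0 (v - 3 * u\<^sup>2) (- (u ^ 3)) \<in> tangent_line u v"
    "coords 0 1 (3 * u) v \<in> tangent_line u v"
    by (simp_all add: tangent_line_def)
  with x have "null_form x (coords 1 0 (v - 3 * u\<^sup>2) (- (u ^ 3))) = 0"
    "null_form x (coords 0 1 (3 * u) v) = 0"
    by (auto simp: null_perp_def)
  then have "x $ 0 * v - x $ 1 * (3 * u) + x $ 2 = 0"
    "- (x $ 0 * u ^ 3) - x $ 1 * (v - 3 * u\<^sup>2) - x $ 3 = 0"
    by (simp_all add: null_form_def)
  then have "x $ 2 = (3 * u\<^sup>2 - v - 3 * u\<^sup>2) * x $ 0 + 3 * u * x $ 1"
    "x $ 3 = (3 * u\<^sup>2 - v) * x $ 1 - u ^ 3 * x $ 0"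
    by algebra+
  then show "x \<in> tangent_line u (3 * u\<^sup>2 - v)"
    by (simp add: tangent_line_def)
next
  fix x assume "x \<in> tangent_line u (3 * u\<^sup>2 - v)"
  then show "x \<in> null_perp (tangent_line u v)"
    by (auto simp: null_perp_def null_form_def tangent_line_def) (simp (no_asm) add: algebra_simps)
qed

lemma null_perp_g_infinity: "null_perp g_infinity = g_infinity"
proof (intro set_eqI iffI)
  fix x :: "'a ^ 4"
  assume x: "x \<in> null_perp g_infinity"
  have "coords 0 0 1 0 \<in> g_infinity" "coords 0 0 0 1 \<in> g_infinity"
    by (simp_all add: g_infinity_def)
  with x have "null_form x (coords 0 0 1 0) = 0" "null_form x (coords 0 0 0 1) = 0"
    by (auto simp: null_perp_def)
  then show "x \<in> g_infinity"
    by (simp add: null_form_def g_infinity_def)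
qed (simp add: null_perp_def null_form_def g_infinity_def)

text \<open>The expansion of \<open>f(p + Tq)\<close> in powers of \<open>T\<close>: the outer
  coefficients are \<open>f(p)\<close> and \<open>f(q)\<close>, the linear one is the derivative of
  \<open>f\<close> at \<open>p\<close> in direction \<open>q\<close>.\<close>

lemma cayley_form_pencil:
  fixes p q :: "'k::field ^ 4"
  shows "cayley_form (\<lambda>i. [:p $ i, q $ i:]) =
    [:p $ 0 * p $ 1 * p $ 2 - p $ 1 ^ 3 - (p $ 0)\<^sup>2 * p $ 3,
      q $ 0 * p $ 1 * p $ 2 + p $ 0 * q $ 1 * p $ 2 + p $ 0 * p $ 1 * q $ 2
        - 3 * (p $ 1)\<^sup>2 * q $ 1 - 2 * p $ 0 * q $ 0 * p $ 3 - (p $ 0)\<^sup>2 * q $ 3,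
      p $ 0 * q $ 1 * q $ 2 + q $ 0 * p $ 1 * q $ 2 + q $ 0 * q $ 1 * p $ 2
        - 3 * p $ 1 * (q $ 1)\<^sup>2 - (q $ 0)\<^sup>2 * p $ 3 - 2 * p $ 0 * q $ 0 * q $ 3,
      q $ 0 * q $ 1 * q $ 2 - q $ 1 ^ 3 - (q $ 0)\<^sup>2 * q $ 3:]"
  by (simp add: cayley_form_def power2_eq_square power3_eq_cube algebra_simps)

lemma monom_3_dvd_iff:
  fixes a b c d :: "'k::field"
  shows "monom 1 3 dvd [:a, b, c, d:] \<longleftrightarrow> a = 0 \<and> b = 0 \<and> c = 0"
  by (auto simp: monom_1_dvd_iff' numeral_3_eq_3 less_Suc_eq)

text \<open>Every monomial of \<open>f\<close> has degree at least 2 in the first two variables, so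
  the surface is singular along \<open>g_infinity\<close>.\<close>

lemma cayley_partial_eq_0:
  assumes "p $ 0 = 0" "p $ 1 = 0"
  shows "cayley_partial i p = 0"
  using exhaust_4[of i] assms
  by (auto simp: four_eq_zero cayley_partial_def cayley_form_def pderiv_mult pderiv_power pderiv_pCons
      power2_eq_square power3_eq_cube)

lemma cayley_partial_3: "cayley_partial 3 p = - (p $ 0)\<^sup>2"
  by (simp add: cayley_partial_def cayley_form_def pderiv_mult pderiv_diff pderiv_pCons
      power2_eq_square power3_eq_cube)

lemma simple_point_coord_0:
  assumes "vec.span {p} \<in> simple_points" "cayley_form (\<lambda>i. p $ i) = 0"
  shows "p $ 0 \<noteq> 0"
proof
  assume p0: "p $ 0 = 0"
  with assms(2) have p1: "p $ 1 = 0"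
    by (simp add: cayley_form_def)
  \<comment> \<open>Simplicity is witnessed by some representative \<open>r\<close>, possibly
    different from \<open>p\<close>; being a multiple of \<open>p\<close>, it too has vanishing
    coordinates 0 and 1.\<close>
  obtain r i where r: "vec.span {p} = vec.span {r}" "cayley_partial i r \<noteq> 0"
    using assms(1) by (auto simp: simple_points_def)
  then have "r \<in> vec.span {p}"
    by (simp add: vec.span_base)
  then obtain c where "r = c *s p"
    by (auto simp: vec.span_singleton)
  with p0 p1 r(2) show False
    by (simp add: cayley_partial_eq_0)
qed

lemma tangent_line_osculating:
  "osculating_tangent_at (vec.span {coords 1 u v (u * v - u ^ 3)}) (tangent_line u v)"
proof -
  let ?p = "coords 1 u v (u * v - u ^ 3)" and ?q = "coords 0 1 (3 * u) v"
  have nz: "?p \<noteq> 0"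
    by (simp add: vec4_eq_iff)
  have "cayley_form (\<lambda>i. ?p $ i) = 0"
    by (simp add: cayley_form_def)
  with nz have "vec.span {?p} \<in> cayley_surface"
    unfolding cayley_surface_def by blast
  moreover have "cayley_partial 3 ?p \<noteq> 0"
    by (simp add: cayley_partial_3)
  ultimately have "vec.span {?p} \<in> simple_points"
    using nz unfolding simple_points_def by blast
  moreover have "monom 1 3 dvd cayley_form (\<lambda>i. [:?p $ i, ?q $ i:])"
    by (simp add: cayley_form_pencil monom_3_dvd_iff) (simp add: algebra_simps power2_eq_square)
  ultimately show ?thesis
    unfolding osculating_tangent_at_def
    using tangent_line_in_proj_lines tangent_line_eq_span by blast
qed

text \<open>The tangent has a point with coordinates 0 and 1 equal to 0 and 1. On a generator,
  \<open>a * s0\<^sup>2 = 0\<close> forces \<open>a * s0 * s1 = 0\<close>, so no such point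
  exists.\<close>

lemma tangent_line_not_generator: "tangent_line u v \<notin> generators"
proof
  assume "tangent_line u v \<in> generators"
  then obtain s0 s1 where
    "tangent_line u v = vec.span {coords (s0\<^sup>2) (s0 * s1) (s1\<^sup>2) 0, coords 0 0 s0 s1}"
    by (auto simp: generators_def)
  moreover have "coords 0 1 (3 * u) v \<in> tangent_line u v"
    by (simp add: tangent_line_def)
  ultimately have "\<exists>a b. coords 0 1 (3 * u) v =
      a *s coords (s0\<^sup>2) (s0 * s1) (s1\<^sup>2) 0 + b *s coords 0 0 s0 s1"
    by (simp add: span_pair)
  then show False
    by (auto simp: vec4_eq_iff)
qed

text \<open>In the following lemma \<open>q\<close> is written as \<open>q\<^sub>0 (1,u,v,w) + (0,a,b,c)\<close>, where
  \<open>p = p\<^sub>0 (1,u,v,w)\<close>. The contact conditions become \<open>a (b - 3ua) = 0\<close> and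
  \<open>c = av + bu - 3u\<^sup>2a\<close>; the case \<open>a = 0\<close> yields the generator through \<open>P(u,v)\<close>.\<close>

lemma osculating_tangent_cases:
  fixes t :: "('k::field ^ 4) set"
  assumes "osculating_tangent_at P t"
  shows "t \<in> generators \<or> (\<exists>u v. t = tangent_line u v)"
proof -
  obtain p q where simple: "vec.span {p} \<in> simple_points" and t: "t \<in> proj_lines"
    and tpq: "t = vec.span {p, q}" and dvd: "monom 1 3 dvd cayley_form (\<lambda>i. [:p $ i, q $ i:])"
    using assms by (auto simp: osculating_tangent_at_def)
  note coeffs = dvd[unfolded cayley_form_pencil monom_3_dvd_iff]
  have p0: "p $ 0 \<noteq> 0"
    using simple coeffs by (intro simple_point_coord_0) (auto simp: cayley_form_def)
  define u v w where "u = p $ 1 / p $ 0" and "v = p $ 2 / p $ 0" and "w = p $ 3 / p $ 0"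
  define a b c where "a = q $ 1 - q $ 0 * u" and "b = q $ 2 - q $ 0 * v" and "c = q $ 3 - q $ 0 * w"
  have p: "p $ 1 = p $ 0 * u" "p $ 2 = p $ 0 * v" "p $ 3 = p $ 0 * w"
    using p0 by (simp_all add: u_def v_def w_def)
  have q: "q $ 1 = q $ 0 * u + a" "q $ 2 = q $ 0 * v + b" "q $ 3 = q $ 0 * w + c"
    by (simp_all add: a_def b_def c_def)
  \<comment> \<open>The constant, linear and quadratic coefficients are used in turn, each
    simplified by the preceding relations; the powers of \<open>p $ 0\<close> come from homogeneity
    of \<open>f\<close>.\<close>
  have "p $ 0 ^ 3 * (u * v - u ^ 3 - w) = 0"
    using coeffs unfolding p q by algebra
  then have w: "w = u * v - u ^ 3"
    using p0 by simp
  have "(p $ 0)\<^sup>2 * (a * v + b * u - 3 * u\<^sup>2 * a - c) = 0"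
    using coeffs w unfolding p q by algebra
  then have c: "c = a * v + b * u - 3 * u\<^sup>2 * a"
    using p0 by simp
  have "p $ 0 * (a * (b - 3 * u * a)) = 0"
    using coeffs w c unfolding p q by algebra
  then consider "a = 0" | "b = 3 * u * a"
    using p0 by auto
  then show ?thesis
  proof cases
    case 1
    \<comment> \<open>The generator with parameters 1 and \<open>u\<close>. The products with 1 stay
      unevaluated so that this literally matches the definition of
      \<open>generators\<close>.\<close>
    let ?G = "vec.span {coords (1\<^sup>2) (1 * u) (u\<^sup>2) 0, coords 0 0 1 u}"
    have "p = p $ 0 *s coords (1\<^sup>2) (1 * u) (u\<^sup>2) 0 + (p $ 0 * (v - u\<^sup>2)) *s coords 0 0 1 u"
      by (simp add: vec4_eq_iff p w algebra_simps power2_eq_square power3_eq_cube)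
    moreover have "q = q $ 0 *s coords (1\<^sup>2) (1 * u) (u\<^sup>2) 0
        + (q $ 0 * (v - u\<^sup>2) + b) *s coords 0 0 1 u"
      by (simp add: vec4_eq_iff q w c 1 algebra_simps power2_eq_square power3_eq_cube)
    ultimately have "{p, q} \<subseteq> ?G"
      unfolding span_pair insert_subset by blast
    then have "t \<subseteq> ?G"
      unfolding tpq by (intro vec.span_minimal) auto
    \<comment> \<open>The upper bound suffices, because \<open>?G\<close> contains the
      two-dimensional \<open>t\<close>.\<close>
    moreover have "vec.dim ?G \<le> 2"
      using vec.dim_le_card'[of "{coords (1\<^sup>2) (1 * u) (u\<^sup>2) 0, coords 0 0 1 u}"]
        card_insert_le_m1[of 2 "{coords 0 0 1 u}"]
      by (simp add: card_insert_if split: if_splits)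
    ultimately have "t = ?G"
      using t by (intro vec.subspace_dim_equal) (auto simp: proj_lines_def)
    moreover have "(1 :: 'k, u) \<noteq> (0, 0)"
      by simp
    ultimately have "t \<in> generators"
      unfolding generators_def by blast
    then show ?thesis ..
  next
    case 2
    have "{p, q} \<subseteq> tangent_line u v"
      by (simp add: tangent_line_def p q w c 2 algebra_simps power2_eq_square power3_eq_cube)
    then have "t \<subseteq> tangent_line u v"
      unfolding tpq using tangent_line_in_proj_lines
      by (intro vec.span_minimal) (auto simp: proj_lines_def)
    then show ?thesis
      using proj_lines_eqI t tangent_line_in_proj_lines by blast
  qed
qed

lemma proper_osculating_tangents_eq:
  "proper_osculating_tangents = {tangent_line u v |u v. True}"
  unfolding proper_osculating_tangents_def
  using osculating_tangent_cases tangent_line_osculating tangent_line_not_generator by blast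

theorem mainTheorem2:
  fixes \<O> :: "('k::field ^ 4) set set"
  assumes "\<O> = proper_osculating_tangents \<union> {g_infinity}"
  shows "(spread \<O> \<longleftrightarrow> dual_spread \<O>) \<and>
         (maximal_partial_spread \<O> \<longleftrightarrow> maximal_partial_dual_spread \<O>)"
proof
  have "null_perp t \<in> \<O>" if "t \<in> \<O>" for t
    using that unfolding assms proper_osculating_tangents_eq
    using null_perp_tangent_line null_perp_g_infinity by blast
  then show "spread \<O> \<longleftrightarrow> dual_spread \<O>"
    by (rule spread_iff_dual_spread_if_null_perp_invariant)
  show "maximal_partial_spread \<O> \<longleftrightarrow> maximal_partial_dual_spread \<O>"
    by (simp add: maximal_partial_spread_def maximal_partial_dual_spread_def
        partial_spread_iff_partial_dual_spread)
qed

end
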